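(* Let $X$ and $Y$ be Tychonoff spaces such that $C_p(X)$ and $C_p(Y)$ are linearly homeomorphic. Then $X$ is a Menger space if and only if $Y$ is a Menger space.
   Context: $C_p(X)$ denotes the vector space of all continuous real-valued functions on $X$ with the topology of pointwise convergence. $C_p(X)$ and $C_p(Y)$ are linearly homeomorphic if there is a linear bijection $C_p(X)\to C_p(Y)$ that is a homeomorphism. A topological space $X$ is Menger if for every sequence $(\mathscr{U}_n)_{n\in\mathbb{N}}$ of open covers of $X$ there is a sequence $(\mathscr{V}_n)_{n\in\mathbb{N}}$ such that each $\mathscr{V}_n$ is a finite subfamily of $\mathscr{U}_n$ and $\bigcup_{n\in\mathbb{N}}\mathscr{V}_n$ covers $X$. *)

theory Defs
  imports "HOL-Analysis.Analysis"
begin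

definition Tychonoff_space :: "'a topology \<Rightarrow> bool" where
  "Tychonoff_space X \<longleftrightarrow> completely_regular_space X \<and> Hausdorff_space X"

definition Menger_space :: "'a topology \<Rightarrow> bool" where
  "Menger_space X \<longleftrightarrow>
    (\<forall>\<U> :: nat \<Rightarrow> 'a set set.
      (\<forall>n. (\<forall>U \<in> \<U> n. openin X U) \<and> \<Union>(\<U> n) = topspace X) \<longrightarrow>
      (\<exists>\<V> :: nat \<Rightarrow> 'a set set.
        (\<forall>n. finite (\<V> n) \<and> \<V> n \<subseteq> \<U> n) \<and> \<Union>(\<Union>n. \<V> n) = topspace X))"

text \<open>
  A continuous real function on \<^term>\<open>X\<close> is represented by its unique extension to the whole type
  taking the value \<^term>\<open>undefined\<close> outside \<^term>\<open>topspace X\<close>, as in product topologies.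
  Hence the vector space operations are restricted to \<^term>\<open>topspace X\<close>.
\<close>

definition Cp :: "'a topology \<Rightarrow> ('a \<Rightarrow> real) topology" where
  "Cp X = subtopology (powertop_real (topspace X)) {f. continuous_map X euclideanreal f}"

definition Cp_add :: "'a topology \<Rightarrow> ('a \<Rightarrow> real) \<Rightarrow> ('a \<Rightarrow> real) \<Rightarrow> ('a \<Rightarrow> real)" where
  "Cp_add X f g = (\<lambda>x\<in>topspace X. f x + g x)"

definition Cp_scale :: "'a topology \<Rightarrow> real \<Rightarrow> ('a \<Rightarrow> real) \<Rightarrow> ('a \<Rightarrow> real)" where
  "Cp_scale X c f = (\<lambda>x\<in>topspace X. c * f x)"

definition Cp_linear ::
    "'a topology \<Rightarrow> 'b topology \<Rightarrow> (('a \<Rightarrow> real) \<Rightarrow> ('b \<Rightarrow> real)) \<Rightarrow> bool" where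
  "Cp_linear X Y T \<longleftrightarrow>
    T \<in> topspace (Cp X) \<rightarrow> topspace (Cp Y) \<and>
    (\<forall>f \<in> topspace (Cp X). \<forall>g \<in> topspace (Cp X). T (Cp_add X f g) = Cp_add Y (T f) (T g)) \<and>
    (\<forall>c. \<forall>f \<in> topspace (Cp X). T (Cp_scale X c f) = Cp_scale Y c (T f))"

definition Cp_linearly_homeomorphic :: "'a topology \<Rightarrow> 'b topology \<Rightarrow> bool" where
  "Cp_linearly_homeomorphic X Y \<longleftrightarrow>
    (\<exists>T. Cp_linear X Y T \<and> homeomorphic_map (Cp X) (Cp Y) T)"

lemma topspace_Cp:
  "topspace (Cp X) = {f \<in> extensional (topspace X). continuous_map X euclideanreal f}"
  by (auto simp: Cp_def PiE_def)

lemma Cp_add_in_Cp: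
  assumes "f \<in> topspace (Cp X)" "g \<in> topspace (Cp X)"
  shows "Cp_add X f g \<in> topspace (Cp X)"
proof -
  have "continuous_map X euclideanreal (\<lambda>x. f x + g x)"
    using assms by (auto simp: topspace_Cp intro: continuous_map_add)
  then show ?thesis
    by (auto simp: topspace_Cp Cp_add_def elim: continuous_map_eq)
qed

lemma Cp_scale_in_Cp:
  assumes "f \<in> topspace (Cp X)"
  shows "Cp_scale X c f \<in> topspace (Cp X)"
proof -
  have "continuous_map X euclideanreal (\<lambda>x. c * f x)"
    using assms by (auto simp: topspace_Cp intro: continuous_map_real_mult_left)
  then show ?thesis
    by (auto simp: topspace_Cp Cp_scale_def elim: continuous_map_eq)
qed

end

theory Submission
  imports Defs
begin

text \<open>
  Let \<open>S\<close> map \<open>C\<^sub>p(Y)\<close> to \<open>C\<^sub>p(X)\<close>, with inverse \<open>T\<close>. By continuity the value of \<open>S g\<close> at a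
  point depends on \<open>g\<close> only through its values on a finite set \<open>s x\<close>, and likewise for \<open>T\<close>.
  Given open covers of \<open>Y\<close>, let player I in the Menger game on \<open>X\<close> cover \<open>X\<close> at stage \<open>n\<close> by the
  sets \<open>{x. \<bar>S (\<phi> u) x\<bar> < 1/(n+1)}\<close>, where \<open>u\<close> ranges over the functions that are \<open>1\<close> off a finite
  union of members of the \<open>n\<close>-th cover, and \<open>\<phi> u\<close> is \<open>u\<close> cut off near the set where all
  functions chosen before are \<open>1\<close>. As \<open>X\<close> is Menger, by Hurewicz's theorem player II has a play in
  which each \<open>x\<close> is covered infinitely often. Let \<open>K\<close> be the set where all chosen functions are
  \<open>1\<close>. On the finite set \<open>s x\<close> the functions \<open>\<phi> u\<close> eventually agree with the indicator of \<open>K\<close>,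
  so \<open>S g x = 0\<close> whenever \<open>g\<close> agrees with this indicator on \<open>s x\<close>. Applying \<open>T\<close> to such an \<open>S g\<close>
  shows that \<open>K\<close> is empty, which means that the chosen finite unions cover \<open>Y\<close>.
\<close>

section \<open>The Menger game\<close>

text \<open>For fixed \<open>n\<close> the sublevel sets of \<open>p n\<close> form an increasing
  open cover, so a finite subfamily is governed by its largest index.\<close>

lemma Menger_space_bounded_once:
  fixes p :: "nat \<Rightarrow> 'a \<Rightarrow> nat"
  assumes "Menger_space X"
    and op: "\<And>n j. openin X {x \<in> topspace X. p n x \<le> j}"
  shows "\<exists>f. \<forall>x\<in>topspace X. \<exists>n. p n x \<le> f n"
proof -
  define P where "P n j = {x \<in> topspace X. p n x \<le> j}" for n j
  have "\<forall>n. (\<forall>U \<in> range (P n). openin X U) \<and> \<Union>(range (P n)) = topspace X"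
    using op by (auto simp: P_def)
  then have "\<exists>\<V>. (\<forall>n. finite (\<V> n) \<and> \<V> n \<subseteq> range (P n)) \<and> \<Union>(\<Union>n. \<V> n) = topspace X"
    by (rule assms(1)[unfolded Menger_space_def, THEN spec, THEN mp])
  then obtain \<V> where fin: "\<And>n. finite (\<V> n)" and sub: "\<And>n. \<V> n \<subseteq> range (P n)"
    and cov: "\<Union>(\<Union>n. \<V> n) = topspace X"
    by meson
  have "\<exists>J. finite J \<and> \<V> n = P n ` J" for n
    using finite_subset_image[OF fin sub, of n] by blast
  then obtain J where J: "\<And>n. finite (J n)" "\<And>n. \<V> n = P n ` J n" by metis
  have "\<exists>n. p n x \<le> Max (J n)" if "x \<in> topspace X" for x
  proof -
    have "x \<in> \<Union>(\<Union>n. P n ` J n)" using that cov J(2) by simp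
    then obtain n j where "j \<in> J n" "x \<in> P n j" by blast
    then have "p n x \<le> j" "j \<le> Max (J n)" using J(1) by (simp_all add: P_def)
    then show ?thesis by (intro exI[of _ n]) (rule le_trans)
  qed
  then have "\<forall>x\<in>topspace X. \<exists>n. p n x \<le> Max (J n)" by (rule ballI)
  then show ?thesis by (rule exI[of _ "\<lambda>n. Max (J n)"])
qed

text \<open>The previous lemma is applied to every tail of \<open>p\<close>; a single
  \<open>f\<close> dominating all the resulting bounds then works beyond every
  \<open>N\<close>.\<close>

lemma Menger_space_frequently_bounded:
  fixes p :: "nat \<Rightarrow> 'a \<Rightarrow> nat"
  assumes "Menger_space X"
    and "\<And>n j. openin X {x \<in> topspace X. p n x \<le> j}"
  obtains f where "strict_mono f" "\<And>x. x \<in> topspace X \<Longrightarrow> \<exists>\<^sub>F n in sequentially. p n x \<le> f n"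
proof -
  have "\<exists>f. \<forall>x\<in>topspace X. \<exists>n. p (N + n) x \<le> f n" for N
    using assms by (intro Menger_space_bounded_once[of X "\<lambda>n. p (N + n)"])
  then obtain F where F: "\<And>N x. x \<in> topspace X \<Longrightarrow> \<exists>n. p (N + n) x \<le> F N n" by metis
  \<comment> \<open>The inner sum at \<open>k = N + n\<close> contains the term
    \<open>F N n\<close>; the outer sum of successors makes \<open>f\<close> strictly
    increasing.\<close>
  define f where "f n = (\<Sum>k\<le>n. Suc (\<Sum>N\<le>k. F N (k - N)))" for n
  have ge: "F N n \<le> f (N + n)" for N n
  proof -
    have "F N n = F N (N + n - N)" by simp
    also have "\<dots> \<le> (\<Sum>M\<le>N + n. F M (N + n - M))" by (rule member_le_sum) auto
    also have "\<dots> \<le> Suc (\<Sum>M\<le>N + n. F M (N + n - M))" by simp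
    also have "\<dots> \<le> f (N + n)" unfolding f_def by (rule member_le_sum) auto
    finally show ?thesis .
  qed
  show thesis
  proof
    show "strict_mono f" by (rule strict_monoI_Suc) (simp add: f_def)
    show "\<exists>\<^sub>F n in sequentially. p n x \<le> f n" if "x \<in> topspace X" for x
      unfolding frequently_sequentially using F[OF that] ge by (metis le_add1 le_trans)
  qed
qed

text \<open>
  Choosing \<^term>\<open>f\<close> above the iterates of \<^term>\<open>b x\<close> infinitely often prevents
  \<^term>\<open>f (Suc n) < b x (f n)\<close> from holding for almost all \<^term>\<open>n\<close>.
\<close>

lemma Menger_game_increasing_covers:
  fixes C :: "nat list \<Rightarrow> nat \<Rightarrow> 'a set"
  assumes "Menger_space X"
    and op: "\<And>\<sigma> k. openin X (C \<sigma> k)"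
    and cov: "\<And>\<sigma>. (\<Union>k. C \<sigma> k) = topspace X"
    and mono: "\<And>\<sigma>. mono (C \<sigma>)"
  obtains f where
    "\<And>x. x \<in> topspace X \<Longrightarrow> \<exists>\<^sub>F n in sequentially. x \<in> C (map f [0..<n]) (f n)"
proof -
  \<comment> \<open>Only finitely many histories have entries at most \<open>k\<close> and length at
    most \<open>k + 1\<close>, so \<open>b x k\<close> can bound the replies that capture
    \<open>x\<close> after all of them. Inserting \<open>k\<close> makes \<open>b x\<close>
    inflationary.\<close>
  define L where "L k = {\<sigma>::nat list. set \<sigma> \<subseteq> {..k} \<and> length \<sigma> \<le> Suc k}" for k
  define h where "h x \<sigma> = (LEAST k. x \<in> C \<sigma> k)" for x \<sigma>
  define b where "b x k = Max (insert k (h x ` L k))" for x k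
  have finL: "finite (L k)" for k unfolding L_def by (rule finite_lists_length_le) simp
  have h_le: "h x \<sigma> \<le> k \<longleftrightarrow> x \<in> C \<sigma> k" if "x \<in> topspace X" for x \<sigma> k
  proof
    have "\<exists>k. x \<in> C \<sigma> k" using that cov by blast
    then have "x \<in> C \<sigma> (h x \<sigma>)" unfolding h_def by (rule LeastI_ex)
    moreover assume "h x \<sigma> \<le> k"
    ultimately show "x \<in> C \<sigma> k" using monoD[OF mono] by blast
  qed (simp add: h_def Least_le)
  have b_le: "b x k \<le> j \<longleftrightarrow> k \<le> j \<and> (\<forall>\<sigma>\<in>L k. h x \<sigma> \<le> j)" for x k j
    unfolding b_def using finL by (subst Max_le_iff) auto
  have b_ge: "k \<le> b x k" for x k using b_le[of x k "b x k"] by simp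
  have b_mono: "mono (b x)" for x
  proof
    fix i k :: nat assume "i \<le> k"
    moreover from this have "L i \<subseteq> L k" by (auto simp: L_def)
    ultimately show "b x i \<le> b x k" using b_le[of x k "b x k"] b_le[of x i "b x k"] by force
  qed
  have b_open: "openin X {x \<in> topspace X. b x k \<le> j}" for k j
  proof (cases "k \<le> j")
    case True
    then have "{x \<in> topspace X. b x k \<le> j} = topspace X \<inter> (\<Inter>\<sigma>\<in>L k. C \<sigma> j)"
      using h_le by (auto simp: b_le)
    also have "openin X \<dots>"
    proof (cases "L k = {}")
      case False
      then show ?thesis using finL op by (intro openin_Int openin_topspace openin_INT2) auto
    qed simp
    finally show ?thesis .
  qed (simp add: b_le)
  have it_open: "openin X {x \<in> topspace X. (b x ^^ n) m \<le> j}" for n m j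
  proof (induction n arbitrary: j)
    case 0
    then show ?case by (cases "m \<le> j") auto
  next
    case (Suc n)
    \<comment> \<open>As \<open>b x\<close> is monotone, bounding the next iterate amounts to
      bounding the current one by some \<open>i\<close> with \<open>b x i \<le> j\<close>.\<close>
    have "{x \<in> topspace X. (b x ^^ Suc n) m \<le> j}
        = (\<Union>i. {x \<in> topspace X. (b x ^^ n) m \<le> i} \<inter> {x \<in> topspace X. b x i \<le> j})"
      using monoD[OF b_mono] by (auto intro: le_trans)
    then show ?case using Suc.IH b_open by (auto intro!: openin_Union)
  qed
  obtain f where f: "strict_mono f"
    and freq: "\<And>x. x \<in> topspace X \<Longrightarrow> \<exists>\<^sub>F n in sequentially. (b x ^^ n) n \<le> f n"
    using Menger_space_frequently_bounded[OF assms(1), of "\<lambda>n x. (b x ^^ n) n"] it_open by blast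
  \<comment> \<open>Strict monotonicity gives \<open>n \<le> f n\<close>, so the length
    \<open>n + 1\<close> is within the bound \<open>Suc (f n)\<close>.\<close>
  have inL: "map f [0..<Suc n] \<in> L (f n)" for n
    using strict_mono_less_eq[OF f] strict_mono_imp_increasing[OF f] by (auto simp: L_def)
  show thesis
  proof
    fix x assume x: "x \<in> topspace X"
    show "\<exists>\<^sub>F n in sequentially. x \<in> C (map f [0..<n]) (f n)"
    proof (rule ccontr)
      assume "\<not> ?thesis"
      then obtain N where N: "\<And>n. n \<ge> N \<Longrightarrow> x \<notin> C (map f [0..<n]) (f n)"
        by (auto simp: not_frequently eventually_sequentially)
      have step: "f (Suc n) < b x (f n)" if "n \<ge> N" for n
      proof -
        have "f (Suc n) < h x (map f [0..<Suc n])"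
          using N[of "Suc n"] that h_le[OF x] by (metis le_SucI not_le)
        also have "\<dots> \<le> b x (f n)" using inL b_le[of x "f n" "b x (f n)"] by blast
        finally show ?thesis .
      qed
      have iter: "f (N + i) \<le> (b x ^^ i) (f N)" for i
      proof (induction i)
        case (Suc i)
        have "f (Suc (N + i)) \<le> b x (f (N + i))" using step[of "N + i"] by simp
        also have "\<dots> \<le> b x ((b x ^^ i) (f N))" by (rule monoD[OF b_mono Suc.IH])
        finally show ?case by simp
      qed simp
      \<comment> \<open>This size yields both \<open>n = N + 1 + i\<close> and
        \<open>f N \<le> n\<close>, so \<open>i + 1\<close> iterates from \<open>f N\<close> stay
        below \<open>n\<close> iterates from \<open>n\<close>.\<close>
      obtain n where n: "n \<ge> Suc N + f N" "(b x ^^ n) n \<le> f n"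
        using freq[OF x] unfolding frequently_sequentially by blast
      define i where "i = n - Suc N"
      have ni: "n = Suc (N + i)" using n(1) by (simp add: i_def)
      have infl: "k \<le> (b x ^^ m) k" for m k
        by (induction m) (auto intro: le_trans[OF _ b_ge])
      have "f n < b x (f (N + i))" using step[of "N + i"] ni by simp
      also have "\<dots> \<le> b x ((b x ^^ i) (f N))" by (rule monoD[OF b_mono iter])
      also have "\<dots> = (b x ^^ Suc i) (f N)" by simp
      also have "\<dots> \<le> (b x ^^ Suc i) n" using n(1) by (intro monoD[OF mono_pow] b_mono) auto
      also have "\<dots> \<le> (b x ^^ N) ((b x ^^ Suc i) n)" by (rule infl)
      also have "\<dots> = (b x ^^ n) n" using funpow_add[of N "Suc i" "b x"] ni by simp
      finally show False using n(2) by simp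
    qed
  qed
qed

text \<open>The Menger property is applied to a constant sequence of covers. This lets the moves of
  player I be enumerated by natural numbers.\<close>

lemma Menger_imp_Lindelof_space:
  assumes "Menger_space X"
  shows "Lindelof_space X"
  unfolding Lindelof_space_def
proof (intro allI impI)
  fix \<U> assume "(\<forall>U\<in>\<U>. openin X U) \<and> \<Union>\<U> = topspace X"
  then have "\<forall>n::nat. (\<forall>U\<in>\<U>. openin X U) \<and> \<Union>\<U> = topspace X" by blast
  then have "\<exists>\<V>. (\<forall>n::nat. finite (\<V> n) \<and> \<V> n \<subseteq> \<U>) \<and> \<Union>(\<Union>n. \<V> n) = topspace X"
    by (rule assms[unfolded Menger_space_def, THEN spec, of "\<lambda>_. \<U>", THEN mp])
  then obtain \<V> where V: "\<And>n::nat. finite (\<V> n)" "\<And>n. \<V> n \<subseteq> \<U>" "\<Union>(\<Union>n. \<V> n) = topspace X"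
    by meson
  then have "countable (\<Union>n. \<V> n)" "(\<Union>n. \<V> n) \<subseteq> \<U>"
    by (auto intro: countable_finite)
  with V(3) show "\<exists>\<V>. countable \<V> \<and> \<V> \<subseteq> \<U> \<and> \<Union>\<V> = topspace X"
    by meson
qed

text \<open>Hurewicz: player I has no winning strategy in the Menger game.\<close>

lemma Menger_game:
  fixes S :: "'i set list \<Rightarrow> 'i \<Rightarrow> 'a set"
  assumes "Menger_space X"
    and op: "\<And>\<sigma> i. i \<in> I \<sigma> \<Longrightarrow> openin X (S \<sigma> i)"
    and cov: "\<And>\<sigma>. (\<Union>i\<in>I \<sigma>. S \<sigma> i) = topspace X"
  obtains A where "\<And>n. finite (A n)" "\<And>n. A n \<subseteq> I (map A [0..<n])"
    "\<And>x. x \<in> topspace X \<Longrightarrow> \<exists>\<^sub>F n in sequentially. \<exists>i\<in>A n. x \<in> S (map A [0..<n]) i"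
\<comment> \<open>Over an empty space the index sets may be empty, which would rule out an
  enumeration \<open>e\<close>.\<close>
proof (cases "topspace X = {}")
  case True
  then show ?thesis using that[of "\<lambda>_. {}"] by simp
next
  case False
  have "\<exists>e :: nat \<Rightarrow> 'i. range e \<subseteq> I \<sigma> \<and> (\<Union>k. S \<sigma> (e k)) = topspace X" for \<sigma>
  proof -
    have "(\<forall>U\<in>S \<sigma> ` I \<sigma>. openin X U) \<and> \<Union>(S \<sigma> ` I \<sigma>) = topspace X"
      using op cov by blast
    then obtain \<V> where V: "countable \<V>" "\<V> \<subseteq> S \<sigma> ` I \<sigma>" "\<Union>\<V> = topspace X"
      using Menger_imp_Lindelof_space[OF assms(1)] unfolding Lindelof_space_def by meson
    obtain I' where I': "countable I'" "I' \<subseteq> I \<sigma>" "\<V> = S \<sigma> ` I'"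
      using V(1,2) countable_subset_image[of \<V> "S \<sigma>" "I \<sigma>"] by auto
    then have "I' \<noteq> {}" using V(3) False by (metis Union_empty image_empty)
    then have "range (from_nat_into I') = I'" using I'(1) by (rule range_from_nat_into)
    then have "(\<Union>k. S \<sigma> (from_nat_into I' k)) = \<Union>(S \<sigma> ` I')" by (metis image_image)
    then show ?thesis using I' V(3) \<open>range (from_nat_into I') = I'\<close>
      by (intro exI[of _ "from_nat_into I'"]) simp
  qed
  then obtain e :: "'i set list \<Rightarrow> nat \<Rightarrow> 'i" where e: "\<And>\<sigma>. range (e \<sigma>) \<subseteq> I \<sigma>"
    "\<And>\<sigma>. (\<Union>k. S \<sigma> (e \<sigma> k)) = topspace X" by metis
  \<comment> \<open>A number \<open>k\<close> encodes the finite set of the first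
    \<open>k + 1\<close> moves at the current history; \<open>H\<close> decodes a list of numbers
    into the actual history. Taking unions in \<open>C\<close> makes the covers increasing.\<close>
  define H where "H = foldl (\<lambda>\<sigma> k. \<sigma> @ [e \<sigma> ` {..k}]) []"
  define C where "C ks k = (\<Union>i\<in>e (H ks) ` {..k}. S (H ks) i)" for ks k
  have 1: "openin X (C ks k)" for ks k
    unfolding C_def using e(1)[of "H ks"] op by (intro openin_Union) auto
  have 2: "(\<Union>k. C ks k) = topspace X" for ks
    using e(2)[of "H ks"] by (auto simp: C_def)
  have 3: "mono (C ks)" for ks
    unfolding C_def by (intro monoI UN_mono image_mono) auto
  obtain f where f: "\<And>x. x \<in> topspace X \<Longrightarrow> \<exists>\<^sub>F n in sequentially. x \<in> C (map f [0..<n]) (f n)"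
    by (rule Menger_game_increasing_covers[where C = C, OF assms(1) 1 2 3]) blast
  define A where "A n = e (H (map f [0..<n])) ` {..f n}" for n
  have H: "H (map f [0..<n]) = map A [0..<n]" for n
    by (induction n) (auto simp: H_def A_def)
  show ?thesis
  proof
    show "finite (A n)" for n by (simp add: A_def)
    show "A n \<subseteq> I (map A [0..<n])" for n
      using e(1)[of "H (map f [0..<n])"] unfolding H[symmetric] by (auto simp: A_def)
    show "\<exists>\<^sub>F n in sequentially. \<exists>i\<in>A n. x \<in> S (map A [0..<n]) i" if "x \<in> topspace X" for x
      using f[OF that] unfolding H[symmetric] by (simp add: C_def A_def)
  qed
qed

section \<open>Separating functions and finite supports in \<open>Cp\<close>\<close>

lemma restrict_in_Cp:
  assumes "continuous_map X euclideanreal f"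
  shows "restrict f (topspace X) \<in> topspace (Cp X)"
  using continuous_map_eq[OF assms, of "restrict f (topspace X)"] by (auto simp: topspace_Cp)

text \<open>The product of functions into \<open>[0,1]\<close> separating the single points of
  \<open>F\<close> from \<open>S\<close> vanishes on all of \<open>F\<close> and remains
  \<open>1\<close> on \<open>S\<close>.\<close>

lemma completely_regular_space_finite_closed_separation:
  assumes "completely_regular_space X" "finite F" "F \<subseteq> topspace X" "closedin X S" "F \<inter> S = {}"
  obtains u where "u \<in> topspace (Cp X)" "\<And>x. x \<in> topspace X \<Longrightarrow> 0 \<le> u x \<and> u x \<le> (1::real)"
    "\<And>x. x \<in> F \<Longrightarrow> u x = 0" "\<And>x. x \<in> S \<Longrightarrow> u x = 1"
proof -
  have "\<exists>f. continuous_map X (top_of_set {0..1::real}) f \<and> f x = 0 \<and> f ` S \<subseteq> {1}" if "x \<in> F" for x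
    using assms that unfolding completely_regular_space_def by blast
  then obtain f where f: "\<And>x. x \<in> F \<Longrightarrow> continuous_map X (top_of_set {0..1::real}) (f x)"
    "\<And>x. x \<in> F \<Longrightarrow> f x x = 0" "\<And>x. x \<in> F \<Longrightarrow> f x ` S \<subseteq> {1}"
    by metis
  have c: "continuous_map X euclideanreal (f x)" "f x ` topspace X \<subseteq> {0..1}" if "x \<in> F" for x
    using f(1)[OF that] by (auto simp: continuous_map_in_subtopology)
  define u where "u = (\<lambda>y\<in>topspace X. \<Prod>x\<in>F. f x y)"
  have "continuous_map X euclideanreal (\<lambda>y. \<Prod>x\<in>F. f x y)"
    using c(1) assms(2) by (intro continuous_map_prod) auto
  then have "u \<in> topspace (Cp X)"
    unfolding u_def by (rule restrict_in_Cp)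
  moreover have "0 \<le> u y \<and> u y \<le> 1" if "y \<in> topspace X" for y
    using c(2) that by (auto simp: u_def image_subset_iff intro!: prod_nonneg prod_le_1)
  moreover have "u y = 0" if "y \<in> F" for y
    using that assms(2,3) f(2) by (auto simp: u_def)
  moreover have "u y = 1" if "y \<in> S" for y
    using that closedin_subset[OF assms(4)] f(3) by (auto simp: u_def image_subset_iff intro!: prod.neutral)
  ultimately show thesis using that by blast
qed

text \<open>By linearity it suffices to apply \<open>zero\<close> to the difference of
  \<open>f\<close> and \<open>g\<close>.\<close>

lemma Cp_linear_eq_if_eq_on_support:
  assumes lin: "Cp_linear X Y T"
    and zero: "\<And>f. f \<in> topspace (Cp X) \<Longrightarrow> (\<And>a. a \<in> A \<Longrightarrow> f a = 0) \<Longrightarrow> T f y = 0"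
    and "A \<subseteq> topspace X" "y \<in> topspace Y" "f \<in> topspace (Cp X)" "g \<in> topspace (Cp X)"
    and eq: "\<And>a. a \<in> A \<Longrightarrow> f a = g a"
  shows "T f y = T g y"
proof -
  have g: "Cp_scale X (-1) g \<in> topspace (Cp X)" using assms(6) by (rule Cp_scale_in_Cp)
  have "T (Cp_add X f (Cp_scale X (-1) g)) = Cp_add Y (T f) (Cp_scale Y (-1) (T g))"
    using lin assms(5,6) g unfolding Cp_linear_def by metis
  moreover have "T (Cp_add X f (Cp_scale X (-1) g)) y = 0"
    using assms(3,5) g eq by (intro zero Cp_add_in_Cp) (auto simp: Cp_add_def Cp_scale_def)
  ultimately show ?thesis using assms(4) by (simp add: Cp_add_def Cp_scale_def)
qed

text \<open>Evaluation of \<open>T f\<close> at \<open>y\<close> is bounded by \<open>1\<close> on a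
  basic neighbourhood of zero, which restricts only finitely many coordinates \<open>A\<close>. A
  function vanishing on \<open>A\<close> has all its multiples in that neighbourhood, which forces
  the value \<open>0\<close>.\<close>

lemma Cp_linear_finite_support:
  assumes lin: "Cp_linear X Y T" and cont: "continuous_map (Cp X) (Cp Y) T" and y: "y \<in> topspace Y"
  obtains A where "finite A" "A \<subseteq> topspace X"
    "\<And>f g. f \<in> topspace (Cp X) \<Longrightarrow> g \<in> topspace (Cp X) \<Longrightarrow> (\<And>a. a \<in> A \<Longrightarrow> f a = g a) \<Longrightarrow> T f y = T g y"
proof -
  define z where "z = (\<lambda>x\<in>topspace X. 0::real)"
  have z: "z \<in> topspace (Cp X)"
    unfolding z_def by (rule restrict_in_Cp) simp
  have scale: "T (Cp_scale X c f) y = c * T f y" if "f \<in> topspace (Cp X)" for c f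
    using lin that y unfolding Cp_linear_def by (simp add: Cp_scale_def)
  have Tz: "T z y = 0"
    using scale[OF z, of 0] by (simp add: Cp_scale_def z_def)
  have "continuous_map (Cp Y) euclideanreal (\<lambda>f. f y)"
    unfolding Cp_def using y
    by (intro continuous_map_from_subtopology continuous_map_product_projection)
  then have "continuous_map (Cp X) euclideanreal (\<lambda>f. T f y)"
    using continuous_map_compose[OF cont] by (simp add: o_def)
  then have "openin (Cp X) {f \<in> topspace (Cp X). T f y \<in> {-1<..<1}}"
    by (intro openin_continuous_map_preimage) auto
  then obtain W where W: "openin (powertop_real (topspace X)) W"
    "{f \<in> topspace (Cp X). T f y \<in> {-1<..<1}} = W \<inter> {f. continuous_map X euclideanreal f}"
    unfolding Cp_def openin_subtopology by blast
  have "z \<in> W \<inter> {f. continuous_map X euclideanreal f}"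
    unfolding W(2)[symmetric] using z Tz by simp
  then have "z \<in> W" by blast
  then obtain U where U: "finite {i \<in> topspace X. U i \<noteq> topspace euclideanreal}"
    "z \<in> Pi\<^sub>E (topspace X) U" "Pi\<^sub>E (topspace X) U \<subseteq> W"
    using W(1)[unfolded openin_product_topology_alt] by blast
  define A where "A = {i \<in> topspace X. U i \<noteq> UNIV}"
  have zero: "T f y = 0" if f: "f \<in> topspace (Cp X)" and fA: "\<And>a. a \<in> A \<Longrightarrow> f a = 0" for f
  proof (rule ccontr)
    assume n: "T f y \<noteq> 0"
    \<comment> \<open>This scaling gives the image the value \<open>1\<close> at \<open>y\<close>,
      just outside the open interval.\<close>
    define c where "c = 1 / T f y"
    have cf: "Cp_scale X c f \<in> topspace (Cp X)" using f by (rule Cp_scale_in_Cp)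
    have "Cp_scale X c f i \<in> U i" if i: "i \<in> topspace X" for i
    proof (cases "i \<in> A")
      case True
      then have "Cp_scale X c f i = z i" using fA i by (simp add: Cp_scale_def z_def)
      then show ?thesis using U(2) i by auto
    qed (use i in \<open>auto simp: A_def\<close>)
    then have "Cp_scale X c f \<in> Pi\<^sub>E (topspace X) U" by (auto simp: Cp_scale_def)
    then have "Cp_scale X c f \<in> W \<inter> {f. continuous_map X euclideanreal f}"
      using U(3) cf by (auto simp: topspace_Cp)
    then have "T (Cp_scale X c f) y \<in> {-1<..<1}" unfolding W(2)[symmetric] by blast
    then show False using scale[OF f, of c] n by (simp add: c_def)
  qed
  show thesis
  proof
    show "finite A" using U(1) by (simp add: A_def)
    show A: "A \<subseteq> topspace X" by (auto simp: A_def)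
    show "T f y = T g y" if "f \<in> topspace (Cp X)" "g \<in> topspace (Cp X)" "\<And>a. a \<in> A \<Longrightarrow> f a = g a" for f g
      using lin zero A y that by (rule Cp_linear_eq_if_eq_on_support)
  qed
qed

section \<open>Transfer of the Menger property\<close>

lemma Menger_space_Cp_linear_transfer:
  fixes X :: "'a topology" and Y :: "'b topology"
  assumes "Menger_space X" and Y: "Tychonoff_space Y"
    and S: "Cp_linear Y X S" "continuous_map (Cp Y) (Cp X) S"
    and T: "Cp_linear X Y T" "continuous_map (Cp X) (Cp Y) T"
    and TS: "\<And>g. g \<in> topspace (Cp Y) \<Longrightarrow> T (S g) = g"
  shows "Menger_space Y"
  unfolding Menger_space_def
proof (intro allI impI)
  fix \<U> :: "nat \<Rightarrow> 'b set set"
  assume \<U>: "\<forall>n. (\<forall>U\<in>\<U> n. openin Y U) \<and> \<Union> (\<U> n) = topspace Y"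
  have SC: "S g \<in> topspace (Cp X)" if "g \<in> topspace (Cp Y)" for g
    using S(1) that unfolding Cp_linear_def by blast
  have reg: "completely_regular_space Y" using Y by (simp add: Tychonoff_space_def)
  have closed: "closedin Y F" if "finite F" "F \<subseteq> topspace Y" for F
    using Y that t1_space_closedin_finite[of Y]
    by (auto simp: Tychonoff_space_def Hausdorff_imp_t1_space)
  have "\<exists>A. finite A \<and> A \<subseteq> topspace Y \<and> (\<forall>f\<in>topspace (Cp Y). \<forall>g\<in>topspace (Cp Y).
      (\<forall>a\<in>A. f a = g a) \<longrightarrow> S f x = S g x)" if "x \<in> topspace X" for x
    using Cp_linear_finite_support[OF S that] by metis
  then obtain s where s: "\<And>x. x \<in> topspace X \<Longrightarrow> finite (s x)"
    "\<And>x. x \<in> topspace X \<Longrightarrow> s x \<subseteq> topspace Y"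
    "\<And>x f g. x \<in> topspace X \<Longrightarrow> f \<in> topspace (Cp Y) \<Longrightarrow> g \<in> topspace (Cp Y) \<Longrightarrow>
      (\<And>a. a \<in> s x \<Longrightarrow> f a = g a) \<Longrightarrow> S f x = S g x"
    by metis

  \<comment> \<open>The bound \<open>u \<le> 1\<close> makes the summands of \<open>D\<close>
    nonnegative, so they cannot cancel. Intersecting with \<open>topspace (Cp Y)\<close> in
    \<open>D\<close> makes it continuous even for histories that no play produces.\<close>
  define I where "I n = {u \<in> topspace (Cp Y). (\<forall>y\<in>topspace Y. u y \<le> 1) \<and>
    (\<exists>V\<subseteq>\<U> n. finite V \<and> (\<forall>y\<in>topspace Y - \<Union>V. u y = 1))}" for n
  define D where "D \<sigma> y = (\<Sum>u\<in>\<Union>(set \<sigma>) \<inter> topspace (Cp Y). 1 - u y)"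
    for \<sigma> :: "('b \<Rightarrow> real) set list" and y
  \<comment> \<open>The cutoff is \<open>1\<close> where \<open>D\<close> vanishes. Where
    \<open>D\<close> stays above a positive constant, the growing factor
    \<open>length \<sigma>\<close> eventually makes it \<open>0\<close>.\<close>
  define \<phi> where "\<phi> \<sigma> u = (\<lambda>y\<in>topspace Y. u y * max 0 (1 - real (length \<sigma>) * D \<sigma> y))" for \<sigma> u
  define Q where "Q \<sigma> u = {x \<in> topspace X. \<bar>S (\<phi> \<sigma> u) x\<bar> < 1 / real (Suc (length \<sigma>))}" for \<sigma> u

  have D_cont: "continuous_map Y euclideanreal (D \<sigma>)" for \<sigma>
  proof (cases "finite (\<Union>(set \<sigma>) \<inter> topspace (Cp Y))")
    case True
    then show ?thesis unfolding D_def
      by (intro continuous_map_sum continuous_map_diff) (auto simp: topspace_Cp)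
  next
    case False
    \<comment> \<open>A sum over an infinite set is \<open>0\<close> by convention.\<close>
    then have "D \<sigma> = (\<lambda>_. 0)" unfolding D_def by (intro ext sum.infinite)
    then show ?thesis by simp
  qed
  have \<phi>_Cp: "\<phi> \<sigma> u \<in> topspace (Cp Y)" if "u \<in> topspace (Cp Y)" for \<sigma> u
  proof -
    have "continuous_map Y euclideanreal (\<lambda>y. u y * max 0 (1 - real (length \<sigma>) * D \<sigma> y))"
      using that D_cont by (intro continuous_map_real_mult continuous_map_real_max
          continuous_map_diff) (auto simp: topspace_Cp)
    then show ?thesis unfolding \<phi>_def by (rule restrict_in_Cp)
  qed
  have Q_open: "openin X (Q \<sigma> u)" if "u \<in> I (length \<sigma>)" for \<sigma> u
  proof -
    let ?e = "1 / real (Suc (length \<sigma>))"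
    have "continuous_map X euclideanreal (S (\<phi> \<sigma> u))"
      using SC[OF \<phi>_Cp] that by (auto simp: I_def topspace_Cp)
    then have "openin X {x \<in> topspace X. S (\<phi> \<sigma> u) x \<in> {-?e<..<?e}}"
      by (intro openin_continuous_map_preimage) auto
    then show ?thesis by (simp add: Q_def abs_less_iff minus_less_iff conj_commute)
  qed
  have zero_Cp: "(\<lambda>y\<in>topspace Y. 0) \<in> topspace (Cp Y)"
    by (rule restrict_in_Cp) simp
  have zero: "S (\<lambda>y\<in>topspace Y. 0) = (\<lambda>x\<in>topspace X. 0)"
  proof -
    have "S (Cp_scale Y 0 (\<lambda>y\<in>topspace Y. 0)) = Cp_scale X 0 (S (\<lambda>y\<in>topspace Y. 0))"
      using S(1) zero_Cp unfolding Cp_linear_def by blast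
    then show ?thesis by (simp add: Cp_scale_def restrict_def)
  qed
  \<comment> \<open>Choosing \<open>u\<close> to vanish on \<open>s x\<close> makes \<open>\<phi> \<sigma> u\<close> vanish there too, whatever the history \<open>\<sigma>\<close>.\<close>
  have Q_cover: "(\<Union>u\<in>I (length \<sigma>). Q \<sigma> u) = topspace X" for \<sigma>
  proof
    show "topspace X \<subseteq> (\<Union>u\<in>I (length \<sigma>). Q \<sigma> u)"
    proof
      fix x assume x: "x \<in> topspace X"
      have "s x \<subseteq> \<Union>(\<U> (length \<sigma>))" using s(2)[OF x] \<U> by simp
      then obtain V where V: "V \<subseteq> \<U> (length \<sigma>)" "finite V" "s x \<subseteq> \<Union>V"
        using finite_subset_Union[OF s(1)[OF x]] by metis
      have "openin Y (\<Union>V)" using V(1) \<U> by auto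
      then have "closedin Y (topspace Y - \<Union>V)" by blast
      moreover have "s x \<inter> (topspace Y - \<Union>V) = {}" using V(3) by blast
      ultimately obtain u where u: "u \<in> topspace (Cp Y)" "\<And>y. y \<in> topspace Y \<Longrightarrow> 0 \<le> u y \<and> u y \<le> 1"
        "\<And>y. y \<in> s x \<Longrightarrow> u y = 0" "\<And>y. y \<in> topspace Y - \<Union>V \<Longrightarrow> u y = 1"
        by (rule completely_regular_space_finite_closed_separation[OF reg s(1)[OF x] s(2)[OF x]]) blast
      have "S (\<phi> \<sigma> u) x = S (\<lambda>y\<in>topspace Y. 0) x"
        using u s(2)[OF x] by (intro s(3)[OF x \<phi>_Cp zero_Cp]) (auto simp: \<phi>_def)
      then have "x \<in> Q \<sigma> u" using x by (simp add: Q_def zero)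
      moreover have "u \<in> I (length \<sigma>)" unfolding I_def using u(1,2,4) V(1,2) by blast
      ultimately show "x \<in> (\<Union>u\<in>I (length \<sigma>). Q \<sigma> u)" by blast
    qed
  qed (auto simp: Q_def)
  obtain A where A: "\<And>n. finite (A n)" "\<And>n. A n \<subseteq> I n"
    and freq: "\<And>x. x \<in> topspace X \<Longrightarrow> \<exists>\<^sub>F n in sequentially. \<exists>u\<in>A n. x \<in> Q (map A [0..<n]) u"
    using Menger_game[of X "\<lambda>\<sigma>. I (length \<sigma>)" Q, OF assms(1) Q_open Q_cover] by auto

  have A_Cp: "u \<in> topspace (Cp Y)"
    and A_le: "\<And>y. y \<in> topspace Y \<Longrightarrow> u y \<le> 1"
    and A_V: "\<exists>V\<subseteq>\<U> n. finite V \<and> (\<forall>y\<in>topspace Y - \<Union>V. u y = 1)" if "u \<in> A n" for n u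
    using A(2)[of n] that unfolding I_def by blast+

  define K where "K = {y \<in> topspace Y. \<forall>n. \<forall>u\<in>A n. u y = 1}"
  have \<phi>_ev: "\<forall>\<^sub>F n in sequentially. \<forall>u\<in>A n. \<phi> (map A [0..<n]) u y = of_bool (y \<in> K)"
    if y: "y \<in> topspace Y" for y
  proof (cases "y \<in> K")
    case True
    have "D (map A [0..<n]) y = 0" for n
      using True unfolding D_def K_def by (intro sum.neutral) auto
    then show ?thesis using True y by (simp add: \<phi>_def K_def)
  next
    case False
    then obtain m w where w: "w \<in> A m" "w y \<noteq> 1" using y by (auto simp: K_def)
    then have wpos: "1 - w y > 0" using A_le[OF w(1) y] by simp
    \<comment> \<open>From stage \<open>m + 1\<close> on, \<open>w\<close> belongs to the history
      and keeps \<open>D\<close> at \<open>y\<close> away from zero.\<close>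
    have D_ge: "1 - w y \<le> D (map A [0..<n]) y" if "m < n" for n
      unfolding D_def
    proof (rule member_le_sum)
      show "w \<in> \<Union> (set (map A [0..<n])) \<inter> topspace (Cp Y)"
        using w that A_Cp by auto
      show "0 \<le> 1 - u y" if "u \<in> \<Union> (set (map A [0..<n])) \<inter> topspace (Cp Y) - {w}" for u
        using that A_le y by auto
    qed (use A(1) in auto)
    have "\<forall>\<^sub>F n in sequentially. 1 / (1 - w y) \<le> real n"
      by (rule eventually_sequentiallyI[of "nat \<lceil>1 / (1 - w y)\<rceil>"]) linarith
    then show ?thesis using eventually_gt_at_top[of m]
    proof eventually_elim
      case (elim n)
      then have "1 \<le> real n * (1 - w y)" using wpos by (simp add: field_simps)
      also have "\<dots> \<le> real n * D (map A [0..<n]) y" using D_ge elim(2) by (intro mult_left_mono) auto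
      finally show ?case using False y by (simp add: \<phi>_def)
    qed
  qed
  have S_zero: "S g x = 0" if x: "x \<in> topspace X" and g: "g \<in> topspace (Cp Y)"
    and gK: "\<And>y. y \<in> s x \<Longrightarrow> g y = of_bool (y \<in> K)" for x g
  proof (rule ccontr)
    assume "S g x \<noteq> 0"
    then have "\<forall>\<^sub>F n in sequentially. 1 / real (Suc n) < \<bar>S g x\<bar>"
      using order_tendstoD(2)[OF LIMSEQ_Suc[OF lim_1_over_n], of "\<bar>S g x\<bar>"] by simp
    \<comment> \<open>Finiteness of \<open>s x\<close> turns the pointwise statement
      \<open>\<phi>_ev\<close> into one uniform over \<open>s x\<close>.\<close>
    moreover have "\<forall>\<^sub>F n in sequentially. \<forall>y\<in>s x. \<forall>u\<in>A n. \<phi> (map A [0..<n]) u y = of_bool (y \<in> K)"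
      by (intro eventually_ball_finite ballI s(1)[OF x] \<phi>_ev subsetD[OF s(2)[OF x]])
    ultimately have "\<forall>\<^sub>F n in sequentially. \<forall>u\<in>A n. x \<notin> Q (map A [0..<n]) u"
    proof eventually_elim
      case (elim n)
      show ?case
      proof
        fix u assume u: "u \<in> A n"
        then have "S (\<phi> (map A [0..<n]) u) x = S g x"
          using elim(2) gK by (intro s(3)[OF x \<phi>_Cp[OF A_Cp] g]) auto
        then show "x \<notin> Q (map A [0..<n]) u" using elim(1) by (simp add: Q_def)
      qed
    qed
    then show False using freq[OF x] by (auto simp: frequently_def elim: eventually_mono)
  qed
  have K_empty: "K = {}"
  proof (rule ccontr)
    assume "K \<noteq> {}"
    then obtain y where yK: "y \<in> K" and y: "y \<in> topspace Y" by (auto simp: K_def)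
    obtain B where B: "finite B" "B \<subseteq> topspace X" "\<And>f g. f \<in> topspace (Cp X) \<Longrightarrow>
        g \<in> topspace (Cp X) \<Longrightarrow> (\<And>a. a \<in> B \<Longrightarrow> f a = g a) \<Longrightarrow> T f y = T g y"
      by (rule Cp_linear_finite_support[OF T y]) blast
    \<comment> \<open>A function equal to the indicator of \<open>K\<close> on \<open>F\<close>
      meets the condition of \<open>S_zero\<close> at every point of \<open>B\<close> and takes the
      value \<open>1\<close> at \<open>y\<close>.\<close>
    define F where "F = insert y (\<Union>x\<in>B. s x)"
    have F: "finite F" "F \<subseteq> topspace Y" using B(1,2) s(1,2) y by (auto simp: F_def)
    have "finite (F - K)" "F - K \<subseteq> topspace Y" "closedin Y (F \<inter> K)" "(F - K) \<inter> (F \<inter> K) = {}"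
      using F by (auto intro!: closed)
    then obtain g where g: "g \<in> topspace (Cp Y)" "\<And>y. y \<in> F - K \<Longrightarrow> g y = 0"
      "\<And>y. y \<in> F \<inter> K \<Longrightarrow> g y = 1"
      by (rule completely_regular_space_finite_closed_separation[OF reg]) blast
    have "S g x = 0" if "x \<in> B" for x
      using that B(2) g by (intro S_zero) (auto simp: F_def)
    \<comment> \<open>\<open>S g\<close> agrees with the zero function on the support
      \<open>B\<close> of evaluation of \<open>T\<close> at \<open>y\<close>.\<close>
    then have "T (S g) y = T (S (\<lambda>y\<in>topspace Y. 0)) y"
      using B(2) g(1) zero_Cp by (intro B(3) SC) (auto simp: zero)
    then have "g y = 0" using TS[OF g(1)] TS[OF zero_Cp] y by simp
    then show False using g(3)[of y] yK by (simp add: F_def)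
  qed

  have "\<exists>V. V \<subseteq> \<U> n \<and> finite V \<and> (u \<in> A n \<longrightarrow> (\<forall>y\<in>topspace Y - \<Union>V. u y = 1))" for n u
    using A_V[of u n] by (cases "u \<in> A n") blast+
  then obtain V where V: "\<And>n u. V n u \<subseteq> \<U> n" "\<And>n u. finite (V n u)"
    "\<And>n u y. u \<in> A n \<Longrightarrow> y \<in> topspace Y \<Longrightarrow> y \<notin> \<Union>(V n u) \<Longrightarrow> u y = 1"
    by (metis DiffI)
  show "\<exists>\<V>. (\<forall>n. finite (\<V> n) \<and> \<V> n \<subseteq> \<U> n) \<and> \<Union> (\<Union>n. \<V> n) = topspace Y"
  proof (intro exI[of _ "\<lambda>n. \<Union>u\<in>A n. V n u"] conjI allI)
    show "\<Union> (\<Union>n. \<Union>u\<in>A n. V n u) = topspace Y"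
    proof
      show "\<Union> (\<Union>n. \<Union>u\<in>A n. V n u) \<subseteq> topspace Y" using V(1) \<U> by blast
      show "topspace Y \<subseteq> \<Union> (\<Union>n. \<Union>u\<in>A n. V n u)"
      proof
        fix y assume y: "y \<in> topspace Y"
        \<comment> \<open>Since \<open>K\<close> is empty, some chosen \<open>u\<close> differs from
          \<open>1\<close> at \<open>y\<close>, which puts \<open>y\<close> in the finite union
          attached to \<open>u\<close>.\<close>
        then obtain n u where u: "u \<in> A n" "u y \<noteq> 1" using K_empty by (auto simp: K_def)
        then have "y \<in> \<Union>(V n u)" using V(3) y by blast
        then show "y \<in> \<Union> (\<Union>n. \<Union>u\<in>A n. V n u)" using u(1) by blast
      qed
    qed
    show "finite (\<Union>u\<in>A n. V n u)" for n using A(1) V(2) by (rule finite_UN_I)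
    show "(\<Union>u\<in>A n. V n u) \<subseteq> \<U> n" for n using V(1) by (rule UN_least)
  qed
qed

section \<open>Symmetry and conclusion\<close>

lemma Cp_linear_inverse:
  assumes T: "Cp_linear X Y T" and hom: "homeomorphic_maps (Cp X) (Cp Y) T S"
  shows "Cp_linear Y X S"
proof -
  have S: "S g \<in> topspace (Cp X)" "T (S g) = g" if "g \<in> topspace (Cp Y)" for g
    using hom that by (auto simp: homeomorphic_maps_def continuous_map_def)
  have ST: "S (T f) = f" if "f \<in> topspace (Cp X)" for f
    using hom that by (auto simp: homeomorphic_maps_def)
  show ?thesis
    unfolding Cp_linear_def
  proof (intro conjI ballI allI)
    fix f g assume fg: "f \<in> topspace (Cp Y)" "g \<in> topspace (Cp Y)"
    have "Cp_add Y f g = T (Cp_add X (S f) (S g))"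
      using T fg S unfolding Cp_linear_def by simp
    then show "S (Cp_add Y f g) = Cp_add X (S f) (S g)"
      using ST S(1) fg by (simp add: Cp_add_in_Cp)
  next
    fix c f assume f: "f \<in> topspace (Cp Y)"
    have "Cp_scale Y c f = T (Cp_scale X c (S f))"
      using T f S unfolding Cp_linear_def by simp
    then show "S (Cp_scale Y c f) = Cp_scale X c (S f)"
      using ST S(1) f by (simp add: Cp_scale_in_Cp)
  qed (use S(1) in blast)
qed

theorem theorem1p1:
  fixes X :: "'a topology" and Y :: "'b topology"
  assumes "Tychonoff_space X" and "Tychonoff_space Y"
    and "Cp_linearly_homeomorphic X Y"
  shows "Menger_space X \<longleftrightarrow> Menger_space Y"
proof -
  obtain T S where T: "Cp_linear X Y T" and hom: "homeomorphic_maps (Cp X) (Cp Y) T S"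
    using assms(3) unfolding Cp_linearly_homeomorphic_def homeomorphic_map_maps by blast
  have S: "Cp_linear Y X S" using T hom by (rule Cp_linear_inverse)
  show ?thesis
    using Menger_space_Cp_linear_transfer[OF _ assms(2) S _ T]
      Menger_space_Cp_linear_transfer[OF _ assms(1) T _ S] hom
    unfolding homeomorphic_maps_def by blast
qed

end
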